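(* The set $\{r_M : M\in\mathcal I\}$ is a homogeneous basis for the subspace $P(C)$ of primitive elements of the matroid-minor coalgebra $C$ (that is, a basis of $P(C)$ each element of which lies in $C_S$ for some $S\in\mathcal U$). Furthermore, if an element $x$ of $P(C)$ has the form $M+y$, where $M\in\mathcal I$ is an irreducible matroid and $y$ is a linear combination of reducible matroids, then $x=r_M$.
   Context: $K$ is a field. Fix an infinite set and let $\mathcal U$ be the set of its finite subsets. $M(S)$ means that $M$ is a matroid with ground set $S$. $\mathcal W$ is the set of all (labeled) matroids $M(S)$ with $S\in\mathcal U$. For a matroid $M(S)$ and $A\subseteq S$, $M|A$ is the restriction to $A$ and $M/A$ is the contraction, a matroid on $S\setminus A$. $\rho(M)$ denotes the rank of $M$. Free product: for matroids $M(S)$, $N(T)$ on disjoint sets, $M\mathbin{\Box}N$ is the matroid on $S\cup T$ whose bases are the sets $B\subseteq S\cup T$ with $|B|=\rho(M)+\rho(N)$ such that $B\cap S$ is independent in $M$ and $B\cap T$ spans $N$; this operation is associative. A matroid is irreducible if it is nonempty (has nonempty ground set) and is not a free product of two nonempty matroids; otherwise it is reducible. $\mathcal I$ and $\mathcal R$ are the sets of irreducible, respectively reducible, matroids in $\mathcal W$. Weak order on $\mathcal W$ (rank-preserving): $M\le N$ means that $M$ and $N$ have the same ground set and every basis of $M$ is a basis of $N$. For $M\in\mathcal W$, let $\mathcal W_M=\{N\in\mathcal W: N\ge M\}$ and let $\mathcal R_M=(\mathcal R\cap\mathcal W_M)\cup\{M\}$, with the order induced from $\mathcal W$. For $N\in\mathcal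 R_M$, $\mu_{\mathcal R}(M,N)$ denotes the value at $(M,N)$ of the Möbius function of the poset $\mathcal R_M$ (where the Möbius function of a poset is given by $\mu(x,x)=1$ and $\mu(x,z)=-\sum_{x\le y<z}\mu(x,y)$ for $x<z$). The matroid-minor coalgebra $C$ is the $K$-vector space with basis $\mathcal W$, with coproduct $\delta(M)=\sum_{A\subseteq S}M|A\otimes M/A$ and counit $\epsilon(M)=1$ if $S=\emptyset$ and $0$ otherwise, for $M=M(S)\in\mathcal W$. $C_S$ is the span of the matroids with ground set $S$, so $C=\bigoplus_{S\in\mathcal U}C_S$. Writing $1$ for the empty matroid, $P(C)=\{x\in\ker\epsilon : \delta(x)=1\otimes x+x\otimes 1\}$. For $M\in\mathcal W$, $r_M=\sum_{N\in\mathcal R_M}\mu_{\mathcal R}(M,N)\,N\in C$. *)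

theory Defs
  imports "HOL-Library.Poly_Mapping" "HOL.Vector_Spaces"
begin

section \<open>Finite labelled matroids\<close>

definition is_matroid :: "'a set \<Rightarrow> 'a set set \<Rightarrow> bool" where
  "is_matroid E I \<longleftrightarrow>
     finite E \<and> I \<subseteq> Pow E \<and> {} \<in> I \<and>
     (\<forall>X\<in>I. \<forall>Y. Y \<subseteq> X \<longrightarrow> Y \<in> I) \<and>
     (\<forall>X\<in>I. \<forall>Y\<in>I. card X < card Y \<longrightarrow> (\<exists>y\<in>Y - X. insert y X \<in> I))"

text \<open>The type of all matroids whose ground set is a finite subset of the universe of the
  label type; this type is the whole set usually written \<open>\<W>\<close>, with the universe of
  the label type in the role of the fixed infinite set of labels.\<close>

typedef 'a matroid = "{(E :: 'a set, I). is_matroid E I}"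
  by (rule exI [of _ "({}, {{}})"]) (simp add: is_matroid_def)

setup_lifting type_definition_matroid

lift_definition ground :: "'a matroid \<Rightarrow> 'a set" is fst .

lift_definition indep_sets :: "'a matroid \<Rightarrow> 'a set set" is snd .

lemma is_matroid_matroid: "is_matroid (ground M) (indep_sets M)"
  by transfer auto

lemma matroid_eqI: "ground M = ground N \<Longrightarrow> indep_sets M = indep_sets N \<Longrightarrow> M = N"
  by transfer auto

lemma finite_ground [simp]: "finite (ground M)"
  using is_matroid_matroid[of M] by (simp add: is_matroid_def)

lemma indep_subset_ground: "X \<in> indep_sets M \<Longrightarrow> X \<subseteq> ground M"
  using is_matroid_matroid[of M] by (auto simp: is_matroid_def)

lemma finite_indep_sets [simp]: "finite (indep_sets M)"
  by (rule finite_subset[of _ "Pow (ground M)"]) (auto dest: indep_subset_ground)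

lemma indep_finite: "X \<in> indep_sets M \<Longrightarrow> finite X"
  using indep_subset_ground finite_ground finite_subset by metis

lemma indep_empty [simp]: "{} \<in> indep_sets M"
  using is_matroid_matroid[of M] by (auto simp: is_matroid_def)

lemma indep_mono: "X \<in> indep_sets M \<Longrightarrow> Y \<subseteq> X \<Longrightarrow> Y \<in> indep_sets M"
  using is_matroid_matroid[of M] unfolding is_matroid_def by blast

lemma indep_augment:
  "X \<in> indep_sets M \<Longrightarrow> Y \<in> indep_sets M \<Longrightarrow> card X < card Y \<Longrightarrow>
    \<exists>y\<in>Y - X. insert y X \<in> indep_sets M"
  using is_matroid_matroid[of M] unfolding is_matroid_def by blast

definition bases :: "'a matroid \<Rightarrow> 'a set set" where
  "bases M = {B \<in> indep_sets M. \<forall>X\<in>indep_sets M. B \<subseteq> X \<longrightarrow> X = B}"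

definition rank :: "'a matroid \<Rightarrow> nat" where
  "rank M = Max (card ` indep_sets M)"

definition spanning :: "'a matroid \<Rightarrow> 'a set \<Rightarrow> bool" where
  "spanning M X \<longleftrightarrow> X \<subseteq> ground M \<and> (\<exists>B\<in>bases M. B \<subseteq> X)"

lemma card_indep_le_rank: "X \<in> indep_sets M \<Longrightarrow> card X \<le> rank M"
  unfolding rank_def by (intro Max_ge) auto

lemma ex_indep_rank: "\<exists>X\<in>indep_sets M. card X = rank M"
proof -
  have "rank M \<in> card ` indep_sets M"
    unfolding rank_def by (intro Max_in) (auto intro: indep_empty)
  then show ?thesis by auto
qed

lemma bases_iff: "B \<in> bases M \<longleftrightarrow> B \<in> indep_sets M \<and> card B = rank M"
proof (intro iffI conjI)
  assume B: "B \<in> bases M"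
  then show BI: "B \<in> indep_sets M" by (simp add: bases_def)
  obtain X where X: "X \<in> indep_sets M" "card X = rank M"
    using ex_indep_rank by blast
  show "card B = rank M"
  proof (rule ccontr)
    assume "card B \<noteq> rank M"
    then have "card B < card X" using card_indep_le_rank[OF BI] X by simp
    then obtain y where "y \<in> X - B" "insert y B \<in> indep_sets M"
      using indep_augment BI X by blast
    then show False using B unfolding bases_def by blast
  qed
next
  assume B: "B \<in> indep_sets M \<and> card B = rank M"
  have "X = B" if "X \<in> indep_sets M" "B \<subseteq> X" for X
    using card_seteq[OF indep_finite[OF that(1)] that(2)] card_indep_le_rank[OF that(1)] B by auto
  then show "B \<in> bases M" using B unfolding bases_def by blast
qed

lemma indep_sets_eq_bases: "indep_sets M = {X. \<exists>B\<in>bases M. X \<subseteq> B}"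
proof (intro equalityI subsetI)
  fix X assume X: "X \<in> indep_sets M"
  let ?F = "{Y \<in> indep_sets M. X \<subseteq> Y}"
  have "finite ?F" "?F \<noteq> {}" using X by auto
  then obtain B where B: "B \<in> ?F" "\<forall>Y\<in>?F. B \<subseteq> Y \<longrightarrow> B = Y"
    using finite_has_maximal[of ?F] by blast
  then have "B \<in> bases M" unfolding bases_def by auto
  then show "X \<in> {X. \<exists>B\<in>bases M. X \<subseteq> B}" using B by auto
next
  fix X assume "X \<in> {X. \<exists>B\<in>bases M. X \<subseteq> B}"
  then show "X \<in> indep_sets M" by (auto simp: bases_def intro: indep_mono)
qed

lemma matroid_eqI_bases: "ground M = ground N \<Longrightarrow> bases M = bases N \<Longrightarrow> M = N"
  by (rule matroid_eqI) (simp_all add: indep_sets_eq_bases)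

subsection \<open>Minors\<close>

lift_definition empty_matroid :: "'a matroid" is "({}, {{}})"
  by (simp add: is_matroid_def)

lift_definition restriction :: "'a matroid \<Rightarrow> 'a set \<Rightarrow> 'a matroid" is
  "\<lambda>M A. (ground M \<inter> A, {X \<in> indep_sets M. X \<subseteq> A})"
proof clarsimp
  fix M :: "'a matroid" and A :: "'a set"
  show "is_matroid (ground M \<inter> A) {X \<in> indep_sets M. X \<subseteq> A}"
    unfolding is_matroid_def
  proof (intro conjI ballI impI allI)
    fix X Y assume "X \<in> {X \<in> indep_sets M. X \<subseteq> A}" "Y \<in> {X \<in> indep_sets M. X \<subseteq> A}"
      and "card X < card Y"
    then show "\<exists>y\<in>Y - X. insert y X \<in> {X \<in> indep_sets M. X \<subseteq> A}"
      using indep_augment[of X M Y] by blast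
  next
    show "{X \<in> indep_sets M. X \<subseteq> A} \<subseteq> Pow (ground M \<inter> A)"
      using indep_subset_ground by fastforce
  next
    fix X Y assume "X \<in> {X \<in> indep_sets M. X \<subseteq> A}" "Y \<subseteq> X"
    then show "Y \<in> {X \<in> indep_sets M. X \<subseteq> A}"
      using indep_mono[of X M Y] by auto
  qed simp_all
qed

lemma ground_restriction [simp]: "ground (restriction M A) = ground M \<inter> A"
  by (simp add: ground.rep_eq indep_sets.rep_eq restriction.rep_eq)

lemma indep_sets_restriction [simp]:
  "indep_sets (restriction M A) = {X \<in> indep_sets M. X \<subseteq> A}"
  by (simp add: ground.rep_eq indep_sets.rep_eq restriction.rep_eq)

lift_definition contraction :: "'a matroid \<Rightarrow> 'a set \<Rightarrow> 'a matroid" is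
  "\<lambda>M A. (ground M - A,
     {X. X \<subseteq> ground M - A \<and> (\<exists>B\<in>bases (restriction M A). X \<union> B \<in> indep_sets M)})"
proof clarsimp
  fix M :: "'a matroid" and A :: "'a set"
  let ?I = "{X. X \<subseteq> ground M - A \<and> (\<exists>B\<in>bases (restriction M A). X \<union> B \<in> indep_sets M)}"
  have sub: "B \<subseteq> A" "finite B" if "B \<in> bases (restriction M A)" for B
    using that by (auto simp: bases_iff intro: indep_finite)
  show "is_matroid (ground M - A) ?I"
    unfolding is_matroid_def
  proof (intro conjI ballI impI allI)
    obtain B where "B \<in> bases (restriction M A)"
      using ex_indep_rank[of "restriction M A"] by (auto simp: bases_iff)
    then show "{} \<in> ?I" by (auto simp: bases_iff)
  next
    fix X Y assume X: "X \<in> ?I" and YX: "Y \<subseteq> X"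
    then obtain B where B: "B \<in> bases (restriction M A)" "X \<union> B \<in> indep_sets M" by auto
    have "Y \<union> B \<in> indep_sets M"
      using B(2) by (rule indep_mono) (use YX in blast)
    moreover have "Y \<subseteq> ground M - A" using X YX by blast
    ultimately show "Y \<in> ?I" using B(1) by blast
  next
    fix X Y assume X: "X \<in> ?I" and Y: "Y \<in> ?I" and less: "card X < card Y"
    from X obtain B where B: "B \<in> bases (restriction M A)" "X \<union> B \<in> indep_sets M" by auto
    from Y obtain B' where B': "B' \<in> bases (restriction M A)" "Y \<union> B' \<in> indep_sets M" by auto
    have fin: "finite X" "finite Y"
      using X Y finite_subset[OF _ finite_ground[of M]] by blast+
    have "card (X \<union> B) = card X + card B" "card (Y \<union> B') = card Y + card B'"
      using sub[OF B(1)] sub[OF B'(1)] X Y fin by (auto intro!: card_Un_disjoint)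
    then have "card (X \<union> B) < card (Y \<union> B')"
      using less B(1) B'(1) by (simp add: bases_iff)
    then obtain y where y: "y \<in> (Y \<union> B') - (X \<union> B)" "insert y (X \<union> B) \<in> indep_sets M"
      using indep_augment[OF B(2) B'(2)] by blast
    have "y \<notin> A"
    proof
      assume "y \<in> A"
      moreover have "insert y B \<in> indep_sets M"
        using y(2) by (rule indep_mono) blast
      ultimately have "insert y B \<in> indep_sets (restriction M A)"
        using sub[OF B(1)] by simp
      then have "insert y B = B" using B(1) unfolding bases_def by blast
      then show False using y(1) by blast
    qed
    then have yY: "y \<in> Y - X" using y(1) sub(1)[OF B'(1)] by blast
    moreover have "insert y X \<subseteq> ground M - A" using yY X Y by blast
    moreover have "insert y X \<union> B \<in> indep_sets M" using y(2) by simp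
    ultimately show "\<exists>y\<in>Y - X. insert y X \<in> ?I" using B(1) by blast
  qed auto
qed

lemma ground_contraction [simp]: "ground (contraction M A) = ground M - A"
  by (simp add: ground.rep_eq indep_sets.rep_eq contraction.rep_eq)

lemma indep_sets_contraction:
  "indep_sets (contraction M A) =
     {X. X \<subseteq> ground M - A \<and> (\<exists>B\<in>bases (restriction M A). X \<union> B \<in> indep_sets M)}"
  by (simp add: ground.rep_eq indep_sets.rep_eq contraction.rep_eq)

subsection \<open>Free product and irreducibility\<close>

text \<open>Only meaningful for disjoint ground sets, where the description determines a unique
  matroid by the lemmas below.\<close>

definition free_product :: "'a matroid \<Rightarrow> 'a matroid \<Rightarrow> 'a matroid" (infixl "\<box>" 75) where
  "M \<box> N = (THE P. ground P = ground M \<union> ground N \<and>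
     bases P = {B. B \<subseteq> ground M \<union> ground N \<and> card B = rank M + rank N \<and>
       B \<inter> ground M \<in> indep_sets M \<and> spanning N (B \<inter> ground N)})"

lemma ex_free_product:
  assumes disj: "ground M \<inter> ground N = {}"
  shows "\<exists>P. ground P = ground M \<union> ground N \<and>
     bases P = {B. B \<subseteq> ground M \<union> ground N \<and> card B = rank M + rank N \<and>
       B \<inter> ground M \<in> indep_sets M \<and> spanning N (B \<inter> ground N)}"
proof -
  define S T where "S = ground M" and "T = ground N"
  define r where "r X = rank (restriction N X)" for X
  have disj: "S \<inter> T = {}" and fST: "finite S" "finite T"
    using assms by (auto simp: S_def T_def)
  have r_ge: "card I \<le> r X" if "I \<in> indep_sets N" "I \<subseteq> X" for I X
    unfolding r_def using that by (intro card_indep_le_rank) simp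
  have r_ex: "\<exists>I\<in>indep_sets N. I \<subseteq> X \<and> card I = r X" for X
    using ex_indep_rank[of "restriction N X"] by (auto simp: r_def)
  have r_mono: "r X \<le> r Y" if "X \<subseteq> Y" for X Y
    using r_ex[of X] r_ge[of _ Y] that by fastforce
  have r_le: "r X \<le> rank N" for X
    using r_ex[of X] card_indep_le_rank[of _ N] by fastforce
  have r_Un: "r Z \<le> r X + card Y" if Z: "Z = X \<union> Y" and "finite Y" for X Y Z
  proof -
    obtain I where I: "I \<in> indep_sets N" "I \<subseteq> Z" "card I = r Z" using r_ex by blast
    have "card I \<le> card ((I \<inter> X) \<union> Y)"
      using I Z \<open>finite Y\<close> indep_finite[OF I(1)] by (intro card_mono) auto
    also have "\<dots> \<le> card (I \<inter> X) + card Y" by (rule card_Un_le)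
    also have "card (I \<inter> X) \<le> r X" using I by (intro r_ge) (auto intro: indep_mono)
    finally show ?thesis using I by simp
  qed
  have r_aug: "\<exists>y\<in>Y - X. r X < r (insert y X)" if less: "r X < r Y" for X Y
  proof -
    obtain I where I: "I \<in> indep_sets N" "I \<subseteq> X" "card I = r X" using r_ex by blast
    obtain J where J: "J \<in> indep_sets N" "J \<subseteq> Y" "card J = r Y" using r_ex by blast
    obtain y where y: "y \<in> J - I" "insert y I \<in> indep_sets N"
      using indep_augment[OF I(1) J(1)] I J less by auto
    have c: "card (insert y I) = Suc (r X)" using y I indep_finite[OF I(1)] by simp
    then have "y \<notin> X" using r_ge[OF y(2), of X] I by auto
    moreover have "r X < r (insert y X)"
      using r_ge[OF y(2), of "insert y X"] c subset_insertI2[OF I(2), of y] by auto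
    ultimately show ?thesis using y J by blast
  qed
  define J where "J = {X. X \<subseteq> S \<union> T \<and> X \<inter> S \<in> indep_sets M \<and> card X \<le> rank M + r (X \<inter> T)}"
  have finJ: "finite X" if "X \<subseteq> S \<union> T" for X
    using that fST finite_subset by blast
  have split: "card X = card (X \<inter> S) + card (X \<inter> T)" if "X \<subseteq> S \<union> T" for X
  proof -
    have "X = (X \<inter> S) \<union> (X \<inter> T)" using that by blast
    then show ?thesis
      using card_Un_disjoint[of "X \<inter> S" "X \<inter> T"] fST disj by auto
  qed
  have "is_matroid (S \<union> T) J"
    unfolding is_matroid_def
  proof (intro conjI ballI impI allI)
    fix X Y assume X: "X \<in> J" and YX: "Y \<subseteq> X"
    have fX: "finite X" using X finJ by (auto simp: J_def)
    have "card X = card Y + card (X - Y)"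
      using card_Un_disjoint[of Y "X - Y"] fX YX finite_subset[of Y X]
      by (metis Diff_disjoint Diff_partition finite_Diff)
    moreover have "r (X \<inter> T) \<le> r (Y \<inter> T) + card ((X - Y) \<inter> T)"
      using YX fX by (intro r_Un) auto
    moreover have "card ((X - Y) \<inter> T) \<le> card (X - Y)"
      using fX by (intro card_mono) auto
    moreover have "card X \<le> rank M + r (X \<inter> T)" using X by (simp add: J_def)
    ultimately have "card Y \<le> rank M + r (Y \<inter> T)" by linarith
    moreover have "Y \<inter> S \<in> indep_sets M"
      using X YX by (auto simp: J_def intro: indep_mono)
    ultimately show "Y \<in> J" using X YX by (auto simp: J_def)
  next
    fix X Y assume X: "X \<in> J" and Y: "Y \<in> J" and less: "card X < card Y"
    have fX: "finite X" and XS: "X \<subseteq> S \<union> T" and YS: "Y \<subseteq> S \<union> T"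
      using X Y finJ by (auto simp: J_def)
    show "\<exists>y\<in>Y - X. insert y X \<in> J"
    proof (cases "r (X \<inter> T) < r (Y \<inter> T)")
      case True
      then obtain y where y: "y \<in> Y \<inter> T - X \<inter> T" "r (X \<inter> T) < r (insert y (X \<inter> T))"
        using r_aug by blast
      have "insert y X \<inter> T = insert y (X \<inter> T)" "insert y X \<inter> S = X \<inter> S"
        using y disj by auto
      then have "insert y X \<in> J"
        using X y fX unfolding J_def by auto
      then show ?thesis using y by blast
    next
      case False
      have slack: "card X < rank M + r (X \<inter> T)"
        using False less Y by (simp add: J_def)
      have slack': "card (insert y X) \<le> rank M + r (insert y X \<inter> T)" for y
      proof -
        have "r (X \<inter> T) \<le> r (insert y X \<inter> T)" by (rule r_mono) auto
        then show ?thesis using slack fX by (auto simp: card_insert_if)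
      qed
      show ?thesis
      proof (cases "Y \<inter> T \<subseteq> X")
        case False
        then obtain y where y: "y \<in> Y" "y \<in> T" "y \<notin> X" by blast
        then have "insert y X \<inter> S = X \<inter> S" using disj by auto
        then have "insert y X \<in> J" using X y slack'[of y] by (auto simp: J_def)
        then show ?thesis using y by blast
      next
        case True
        then have "card (Y \<inter> T) \<le> card (X \<inter> T)"
          using fX by (intro card_mono) auto
        then have "card (X \<inter> S) < card (Y \<inter> S)"
          using split[OF XS] split[OF YS] less by linarith
        then obtain y where y: "y \<in> Y \<inter> S - X \<inter> S" "insert y (X \<inter> S) \<in> indep_sets M"
          using indep_augment[of "X \<inter> S" M "Y \<inter> S"] X Y by (auto simp: J_def)
        then have "insert y X \<inter> S = insert y (X \<inter> S)" by auto
        then have "insert y X \<in> J" using X y slack'[of y] by (auto simp: J_def)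
        then show ?thesis using y by blast
      qed
    qed
  qed (use fST in \<open>auto simp: J_def\<close>)
  then have inv: "ground (Abs_matroid (S \<union> T, J)) = S \<union> T"
      "indep_sets (Abs_matroid (S \<union> T, J)) = J"
    by (simp_all add: ground.rep_eq indep_sets.rep_eq Abs_matroid_inverse)
  define P where "P = Abs_matroid (S \<union> T, J)"
  have P: "ground P = S \<union> T" "indep_sets P = J" using inv by (simp_all add: P_def)
  have rankP: "rank P = rank M + rank N"
  proof (rule antisym)
    obtain X where X: "X \<in> J" "card X = rank P" using ex_indep_rank[of P] P by auto
    then show "rank P \<le> rank M + rank N" using r_le[of "X \<inter> T"] by (simp add: J_def)
    obtain A where A: "A \<in> indep_sets M" "card A = rank M" using ex_indep_rank by blast
    obtain B where B: "B \<in> indep_sets N" "card B = rank N" using ex_indep_rank by blast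
    have AB: "A \<subseteq> S" "B \<subseteq> T"
      using A B indep_subset_ground by (auto simp: S_def T_def)
    then have i: "(A \<union> B) \<inter> S = A" "(A \<union> B) \<inter> T = B" using disj by auto
    have c: "card (A \<union> B) = rank M + rank N"
      using split[of "A \<union> B"] AB i A B by auto
    have "card B \<le> r B" using r_ge B by blast
    then have "A \<union> B \<in> J" using A B AB i c by (auto simp: J_def)
    then show "rank M + rank N \<le> rank P" using card_indep_le_rank[of "A \<union> B" P] P c by simp
  qed
  have span: "spanning N X \<longleftrightarrow> rank N \<le> r X" if "X \<subseteq> T" for X
  proof
    assume "spanning N X"
    then obtain B where "B \<in> bases N" "B \<subseteq> X" by (auto simp: spanning_def)
    then show "rank N \<le> r X" using r_ge[of B X] by (simp add: bases_iff)
  next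
    assume "rank N \<le> r X"
    then have "r X = rank N" using r_le[of X] by simp
    then show "spanning N X"
      using r_ex[of X] that by (auto simp: spanning_def bases_iff T_def)
  qed
  have "bases P = {B. B \<subseteq> S \<union> T \<and> card B = rank M + rank N \<and>
       B \<inter> S \<in> indep_sets M \<and> spanning N (B \<inter> T)}"
    by (auto simp: bases_iff P rankP J_def span)
  then show ?thesis using P unfolding S_def T_def by blast
qed

lemma
  assumes "ground M \<inter> ground N = {}"
  shows ground_free_product: "ground (M \<box> N) = ground M \<union> ground N" (is ?g)
    and bases_free_product:
      "bases (M \<box> N) = {B. B \<subseteq> ground M \<union> ground N \<and> card B = rank M + rank N \<and>
         B \<inter> ground M \<in> indep_sets M \<and> spanning N (B \<inter> ground N)}" (is ?b)
proof -
  let ?Q = "\<lambda>P. ground P = ground M \<union> ground N \<and>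
     bases P = {B. B \<subseteq> ground M \<union> ground N \<and> card B = rank M + rank N \<and>
       B \<inter> ground M \<in> indep_sets M \<and> spanning N (B \<inter> ground N)}"
  obtain P where P: "?Q P" using ex_free_product[OF assms] by blast
  have "Q = P" if "?Q Q" for Q
    using that P by (intro matroid_eqI_bases) simp_all
  then have "?Q (M \<box> N)"
    unfolding free_product_def using P by (rule theI[of ?Q, rotated])
  then show ?g ?b by blast+
qed

definition irreducible_matroid :: "'a matroid \<Rightarrow> bool" where
  "irreducible_matroid M \<longleftrightarrow> ground M \<noteq> {} \<and>
     \<not> (\<exists>N P. ground N \<noteq> {} \<and> ground P \<noteq> {} \<and> ground N \<inter> ground P = {} \<and> M = N \<box> P)"

text \<open>In particular the empty matroid counts as reducible.\<close>

definition reducible_matroid :: "'a matroid \<Rightarrow> bool" where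
  "reducible_matroid M \<longleftrightarrow> \<not> irreducible_matroid M"

subsection \<open>Weak order\<close>

instantiation matroid :: (type) order
begin

definition less_eq_matroid :: "'a matroid \<Rightarrow> 'a matroid \<Rightarrow> bool" where
  "M \<le> N \<longleftrightarrow> ground M = ground N \<and> bases M \<subseteq> bases N"

definition less_matroid :: "'a matroid \<Rightarrow> 'a matroid \<Rightarrow> bool" where
  "M < N \<longleftrightarrow> M \<le> N \<and> \<not> N \<le> M" for M N :: "'a matroid"

instance
  by standard
     (auto simp: less_eq_matroid_def less_matroid_def intro: matroid_eqI_bases)

end

definition R_above :: "'a matroid \<Rightarrow> 'a matroid set" where
  "R_above M = insert M {N. reducible_matroid N \<and> M \<le> N}"

lemma finite_R_above [simp]: "finite (R_above M)"
proof -
  have "finite {N :: 'a matroid. ground N = ground M}"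
  proof (rule inj_on_finite[of indep_sets _ "Pow (Pow (ground M))"])
    show "inj_on indep_sets {N. ground N = ground M}"
      by (auto simp: inj_on_def intro: matroid_eqI)
    show "indep_sets ` {N. ground N = ground M} \<subseteq> Pow (Pow (ground M))"
      using indep_subset_ground by fastforce
  qed simp
  then show ?thesis
    by (rule rev_finite_subset) (auto simp: R_above_def less_eq_matroid_def)
qed

section \<open>Moebius function of a locally finite poset\<close>

text \<open>The poset is a subset \<open>P\<close> of an ordered type. The value is \<open>0\<close> outside the
  intended domain \<open>x \<le> z\<close>; finiteness of the interval makes the recursion terminate.\<close>

function moebius :: "'b::order set \<Rightarrow> 'b \<Rightarrow> 'b \<Rightarrow> int" where
  "moebius P x z =
     (if x \<in> P \<and> z \<in> P \<and> x \<le> z \<and> finite {y \<in> P. x \<le> y \<and> y \<le> z}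
      then if x = z then 1 else - (\<Sum>y\<in>{y \<in> P. x \<le> y \<and> y < z}. moebius P x y)
      else 0)"
  by auto
termination
proof (relation "measure (\<lambda>(P, x, z). card {y \<in> P. x \<le> y \<and> y \<le> z})")
  fix P and x z y :: "'b :: order"
  assume a: "x \<in> P \<and> z \<in> P \<and> x \<le> z \<and> finite {y \<in> P. x \<le> y \<and> y \<le> z}"
    and y: "y \<in> {y \<in> P. x \<le> y \<and> y < z}"
  have "{w \<in> P. x \<le> w \<and> w \<le> y} \<subset> {w \<in> P. x \<le> w \<and> w \<le> z}"
  proof (rule psubsetI)
    show "{w \<in> P. x \<le> w \<and> w \<le> y} \<subseteq> {w \<in> P. x \<le> w \<and> w \<le> z}"
      using y by (auto intro: order_trans less_imp_le)
    have "z \<in> {w \<in> P. x \<le> w \<and> w \<le> z}" "z \<notin> {w \<in> P. x \<le> w \<and> w \<le> y}"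
      using a y by auto
    then show "{w \<in> P. x \<le> w \<and> w \<le> y} \<noteq> {w \<in> P. x \<le> w \<and> w \<le> z}" by blast
  qed
  then show "((P, x, y), (P, x, z)) \<in> measure (\<lambda>(P, x, z). card {y \<in> P. x \<le> y \<and> y \<le> z})"
    using a by (simp add: psubset_card_mono)
qed simp

declare moebius.simps [simp del]

section \<open>Free vector spaces\<close>

text \<open>\<open>'b \<Rightarrow>\<^sub>0 'k\<close> is the vector space with basis the elements of \<open>'b\<close>.\<close>

definition scale :: "'k::field \<Rightarrow> ('b \<Rightarrow>\<^sub>0 'k) \<Rightarrow> ('b \<Rightarrow>\<^sub>0 'k)" where
  "scale c x = Poly_Mapping.map ((*) c) x"

lemma lookup_scale [simp]: "Poly_Mapping.lookup (scale c x) b = c * Poly_Mapping.lookup x b"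
  by (simp add: scale_def map.rep_eq when_def)

global_interpretation free_vs: vector_space "scale :: 'k::field \<Rightarrow> ('b \<Rightarrow>\<^sub>0 'k) \<Rightarrow> ('b \<Rightarrow>\<^sub>0 'k)"
  by standard (auto intro!: poly_mapping_eqI simp: lookup_add algebra_simps)

definition basis_vec :: "'b \<Rightarrow> ('b \<Rightarrow>\<^sub>0 'k::field)" where
  "basis_vec b = Poly_Mapping.single b 1"

definition lin_ext :: "('b \<Rightarrow> ('c \<Rightarrow>\<^sub>0 'k)) \<Rightarrow> ('b \<Rightarrow>\<^sub>0 'k) \<Rightarrow> ('c \<Rightarrow>\<^sub>0 'k::field)" where
  "lin_ext f x = (\<Sum>b\<in>Poly_Mapping.keys x. scale (Poly_Mapping.lookup x b) (f b))"

text \<open>The tensor product of the spaces with bases \<open>'b\<close> and \<open>'c\<close> is taken to be the space with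
  basis \<open>'b \<times> 'c\<close>, the pair \<open>(b, c)\<close> standing for the tensor of the two basis vectors.\<close>

definition tensor :: "('b \<Rightarrow>\<^sub>0 'k) \<Rightarrow> ('c \<Rightarrow>\<^sub>0 'k) \<Rightarrow> (('b \<times> 'c) \<Rightarrow>\<^sub>0 'k::field)" (infixr "\<otimes>" 70) where
  "x \<otimes> y = (\<Sum>b\<in>Poly_Mapping.keys x. \<Sum>c\<in>Poly_Mapping.keys y.
     Poly_Mapping.single (b, c) (Poly_Mapping.lookup x b * Poly_Mapping.lookup y c))"

section \<open>The matroid-minor coalgebra\<close>

definition coproduct :: "('a matroid \<Rightarrow>\<^sub>0 'k::field) \<Rightarrow> (('a matroid \<times> 'a matroid) \<Rightarrow>\<^sub>0 'k)" where
  "coproduct = lin_ext (\<lambda>M. \<Sum>A\<in>Pow (ground M).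
     basis_vec (restriction M A) \<otimes> basis_vec (contraction M A))"

definition counit :: "('a matroid \<Rightarrow>\<^sub>0 'k::field) \<Rightarrow> 'k" where
  "counit x = (\<Sum>M\<in>Poly_Mapping.keys x.
     Poly_Mapping.lookup x M * (if ground M = {} then 1 else 0))"

definition primitives :: "('a matroid \<Rightarrow>\<^sub>0 'k::field) set" where
  "primitives = {x. counit x = 0 \<and>
     coproduct x = basis_vec empty_matroid \<otimes> x + x \<otimes> basis_vec empty_matroid}"

definition homogeneous_component :: "'a set \<Rightarrow> ('a matroid \<Rightarrow>\<^sub>0 'k::field) set" where
  "homogeneous_component S = free_vs.span (basis_vec ` {M. ground M = S})"

definition r_elem :: "'a matroid \<Rightarrow> ('a matroid \<Rightarrow>\<^sub>0 'k::field)" where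
  "r_elem M = (\<Sum>N\<in>R_above M. scale (of_int (moebius (R_above M) M N)) (basis_vec N))"

end

theory Submission
  imports Defs
begin

text \<open>
  For \<open>A \<subseteq> S\<close> the map \<open>P \<mapsto> P|A \<box> P/A\<close> is a closure operator for the weak order on the matroids
  on \<open>S\<close>: the bases of its value are the sets \<open>B\<close> of cardinality \<open>\<rho>(P)\<close> with \<open>B \<inter> A\<close>
  independent and \<open>B \<union> A\<close> spanning in \<open>P\<close>.  If \<open>A\<close> is nonempty and proper, its values are reducible,
  so it acts on \<open>\<R>\<^sub>M\<close>, and an irreducible \<open>M\<close> is not closed.  By Crapo's closure theorem the
  Moebius function of \<open>\<R>\<^sub>M\<close> sums to zero over its fibres, which says that \<open>r\<^sub>M\<close> is primitive.
  Conversely, if \<open>N \<box> Q\<close> is a minimal reducible matroid in the support of \<open>x\<close>, and all the support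
  is reducible, the coefficient of \<open>N \<otimes> Q\<close> in \<open>\<delta>(x)\<close> is the coefficient of \<open>N \<box> Q\<close> in \<open>x\<close>, because
  \<open>N \<box> Q\<close> is the greatest matroid with restriction \<open>N\<close> and contraction \<open>Q\<close>.  Hence no nonzero
  primitive element is supported on reducible matroids.
\<close>

section \<open>Free products and the weak order\<close>

lemma bases_subset_ground: "B \<in> bases M \<Longrightarrow> B \<subseteq> ground M"
  by (simp add: bases_iff indep_subset_ground)

lemma finite_bases_mem: "B \<in> bases M \<Longrightarrow> finite B"
  by (auto simp: bases_iff intro: indep_finite)

lemma ex_basis: "\<exists>B. B \<in> bases M"
  using ex_indep_rank by (auto simp: bases_iff)

lemma indep_iff_subset_basis: "X \<in> indep_sets M \<longleftrightarrow> (\<exists>B\<in>bases M. X \<subseteq> B)"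
  by (subst indep_sets_eq_bases) simp

text \<open>A maximal independent set between \<open>X\<close> and \<open>Y\<close> cannot be
  smaller than a basis contained in \<open>Y\<close>, since augmentation from that basis would
  enlarge it within \<open>Y\<close>.\<close>

lemma indep_extend_in_spanning:
  assumes X: "X \<in> indep_sets M" "X \<subseteq> Y" and Y: "spanning M Y"
  shows "\<exists>B\<in>bases M. X \<subseteq> B \<and> B \<subseteq> Y"
proof -
  let ?F = "{Z \<in> indep_sets M. X \<subseteq> Z \<and> Z \<subseteq> Y}"
  have "finite ?F" "?F \<noteq> {}" using X by auto
  then obtain B where B: "B \<in> ?F" "\<forall>Z\<in>?F. B \<subseteq> Z \<longrightarrow> B = Z"
    using finite_has_maximal[of ?F] by blast
  obtain D where D: "D \<in> bases M" "D \<subseteq> Y" using Y by (auto simp: spanning_def)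
  have "\<not> card B < card D"
  proof
    assume "card B < card D"
    then obtain y where "y \<in> D - B" "insert y B \<in> indep_sets M"
      using indep_augment[of B M D] B D by (auto simp: bases_iff)
    then show False using B D by blast
  qed
  then have "B \<in> bases M"
    using B D card_indep_le_rank[of B M] by (auto simp: bases_iff)
  then show ?thesis using B by blast
qed

text \<open>For one inequality, a basis of the contraction is joined to a basis of the restriction.
  For the other, a basis \<open>D\<close> of \<open>M\<close> is cut along \<open>A\<close>: both
  pieces are independent in the respective minors.\<close>

lemma rank_restriction_contraction:
  assumes A: "A \<subseteq> ground M"
  shows "rank (restriction M A) + rank (contraction M A) = rank M"
proof (rule antisym)
  obtain X where X: "X \<in> bases (contraction M A)" using ex_basis by blast
  then obtain B where B: "B \<in> bases (restriction M A)" "X \<union> B \<in> indep_sets M" "X \<subseteq> ground M - A"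
    by (auto simp: bases_iff[of X] indep_sets_contraction)
  have "card (X \<union> B) = card X + card B"
    using finite_bases_mem[OF X] finite_bases_mem[OF B(1)] bases_subset_ground[OF B(1)] B(3)
    by (intro card_Un_disjoint) auto
  then show "rank (restriction M A) + rank (contraction M A) \<le> rank M"
    using X B card_indep_le_rank[OF B(2)] by (simp add: bases_iff)
next
  obtain B where B: "B \<in> bases (restriction M A)" using ex_basis by blast
  then obtain D where D: "D \<in> bases M" "B \<subseteq> D"
    by (auto simp: bases_iff[of B] indep_iff_subset_basis[of B])
  have "D \<inter> A \<in> indep_sets (restriction M A)"
    using D by (auto simp: bases_iff intro: indep_mono)
  then have c1: "card (D \<inter> A) \<le> rank (restriction M A)" by (rule card_indep_le_rank)
  have "(D - A) \<union> B \<in> indep_sets M"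
    using D by (auto simp: bases_iff intro: indep_mono)
  then have "D - A \<in> indep_sets (contraction M A)"
    using B bases_subset_ground[OF D(1)] by (auto simp: indep_sets_contraction)
  then have "card (D - A) \<le> rank (contraction M A)" by (rule card_indep_le_rank)
  moreover have "card D = card (D \<inter> A) + card (D - A)"
    using finite_bases_mem[OF D(1)] by (rule card_Int_Diff)
  ultimately show "rank M \<le> rank (restriction M A) + rank (contraction M A)"
    using c1 D by (simp add: bases_iff)
qed

text \<open>Bases of \<open>M\<close> inside \<open>X \<union> A\<close> that extend a basis of the
  restriction correspond to bases of the contraction inside \<open>X\<close>. The rank formula
  upgrades independent sets to bases in both directions.\<close>

lemma spanning_contraction_iff:
  assumes A: "A \<subseteq> ground M" and X: "X \<subseteq> ground M - A"
  shows "spanning (contraction M A) X \<longleftrightarrow> spanning M (X \<union> A)"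
proof
  have card: "card (Y \<union> B) = card Y + rank (restriction M A)"
    if "B \<in> bases (restriction M A)" "Y \<subseteq> ground M - A" for Y B
  proof -
    have "card (Y \<union> B) = card Y + card B"
      using that finite_bases_mem[OF that(1)] bases_subset_ground[OF that(1)] finite_subset[of Y "ground M"]
      by (intro card_Un_disjoint) auto
    then show ?thesis using that by (simp add: bases_iff)
  qed
  {
    assume "spanning (contraction M A) X"
    then obtain Y where Y: "Y \<in> bases (contraction M A)" "Y \<subseteq> X" by (auto simp: spanning_def)
    then obtain B where B: "B \<in> bases (restriction M A)" "Y \<union> B \<in> indep_sets M"
      by (auto simp: bases_iff[of Y] indep_sets_contraction)
    have "Y \<union> B \<in> bases M"
      using B Y X card[OF B(1), of Y] rank_restriction_contraction[OF A]
      by (auto simp: bases_iff)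
    moreover have "B \<subseteq> A" using bases_subset_ground[OF B(1)] by auto
    ultimately have "\<exists>B\<in>bases M. B \<subseteq> X \<union> A"
      using Y(2) by (intro bexI[of _ "Y \<union> B"]) auto
    then show "spanning M (X \<union> A)" using X A by (auto simp: spanning_def)
  next
    assume sp: "spanning M (X \<union> A)"
    obtain B where B: "B \<in> bases (restriction M A)" using ex_basis by blast
    then have "B \<in> indep_sets M" "B \<subseteq> X \<union> A" by (auto simp: bases_iff)
    then obtain D where D: "D \<in> bases M" "B \<subseteq> D" "D \<subseteq> X \<union> A"
      using indep_extend_in_spanning[OF _ _ sp] by blast
    have "D \<inter> A \<in> indep_sets (restriction M A)"
      using D by (auto simp: bases_iff intro: indep_mono)
    moreover have "B \<subseteq> D \<inter> A" using D B by (auto simp: bases_iff)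
    \<comment> \<open>\<open>B\<close> is a maximal independent subset of \<open>A\<close>, so
      \<open>D\<close> cannot meet \<open>A\<close> in more.\<close>
    ultimately have DA: "D \<inter> A = B" using B unfolding bases_def by blast
    have DX: "D - A \<subseteq> X" using D by blast
    have eq: "(D - A) \<union> B = D" using DA by blast
    have "D - A \<in> indep_sets (contraction M A)"
    proof -
      have "(D - A) \<union> B \<in> indep_sets M" using D eq by (simp add: bases_iff)
      moreover have "D - A \<subseteq> ground M - A" using DX X by blast
      ultimately show ?thesis using B unfolding indep_sets_contraction by blast
    qed
    moreover have "card (D - A) = rank (contraction M A)"
      using card[OF B, of "D - A"] DX X eq D rank_restriction_contraction[OF A]
      by (auto simp: bases_iff)
    ultimately have "D - A \<in> bases (contraction M A)" by (simp add: bases_iff)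
    then show "spanning (contraction M A) X"
      using DX X unfolding spanning_def by auto
  }
qed

section \<open>The closure operator attached to a subset of the ground set\<close>

definition free_closure :: "'a set \<Rightarrow> 'a matroid \<Rightarrow> 'a matroid" where
  "free_closure A P = restriction P A \<box> contraction P A"

lemma ground_free_closure [simp]: "A \<subseteq> ground P \<Longrightarrow> ground (free_closure A P) = ground P"
  unfolding free_closure_def by (subst ground_free_product) auto

text \<open>Eliminating the minors leaves only rank, independence and spanning in \<open>P\<close>
  itself. Rank is constant along the weak order and the other two pass upwards, so monotonicity
  becomes immediate.\<close>

lemma bases_free_closure:
  assumes A: "A \<subseteq> ground P"
  shows "bases (free_closure A P) =
    {B. B \<subseteq> ground P \<and> card B = rank P \<and> B \<inter> A \<in> indep_sets P \<and> spanning P (B \<union> A)}"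
proof -
  have *: "spanning (contraction P A) (B \<inter> (ground P - A)) \<longleftrightarrow> spanning P (B \<union> A)"
    if "B \<subseteq> ground P" for B
  proof -
    have "B \<inter> (ground P - A) \<union> A = B \<union> A" using that by blast
    then show ?thesis using spanning_contraction_iff[OF A, of "B \<inter> (ground P - A)"] by simp
  qed
  have gA: "ground P \<inter> A = A" "A \<union> ground P = ground P"
    using A by auto
  have "bases (free_closure A P) = {B. B \<subseteq> ground (restriction P A) \<union> ground (contraction P A) \<and>
      card B = rank (restriction P A) + rank (contraction P A) \<and>
      B \<inter> ground (restriction P A) \<in> indep_sets (restriction P A) \<and>
      spanning (contraction P A) (B \<inter> ground (contraction P A))}"
    unfolding free_closure_def by (rule bases_free_product) auto
  then show ?thesis
    by (auto simp: gA rank_restriction_contraction[OF A] *)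
qed

lemma weak_order_rank: "M \<le> N \<Longrightarrow> rank M = rank N"
  using ex_basis[of M] by (auto simp: less_eq_matroid_def bases_iff)

lemma weak_order_indep: "M \<le> N \<Longrightarrow> X \<in> indep_sets M \<Longrightarrow> X \<in> indep_sets N"
  by (auto simp: indep_iff_subset_basis less_eq_matroid_def)

lemma weak_order_spanning: "M \<le> N \<Longrightarrow> spanning M X \<Longrightarrow> spanning N X"
  by (auto simp: spanning_def less_eq_matroid_def)

lemma weak_order_ground: "M \<le> N \<Longrightarrow> ground M = ground N"
  by (simp add: less_eq_matroid_def)

text \<open>For a basis \<open>B\<close> of \<open>P\<close>, \<open>B \<inter> A\<close> is
  independent as a subset of \<open>B\<close>, and \<open>B \<union> A\<close> spans because it
  contains \<open>B\<close>.\<close>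

lemma free_closure_extensive: "A \<subseteq> ground P \<Longrightarrow> P \<le> free_closure A P"
  using bases_subset_ground
  by (fastforce simp: less_eq_matroid_def bases_free_closure spanning_def bases_iff
      intro: indep_mono)

lemma free_closure_mono:
  assumes "A \<subseteq> ground P" "P \<le> Q"
  shows "free_closure A P \<le> free_closure A Q"
  using assms weak_order_ground[OF assms(2)]
  by (auto simp: less_eq_matroid_def[of "free_closure A P"] bases_free_closure weak_order_rank
      intro: weak_order_indep weak_order_spanning)

section \<open>Recovering both factors from a free product\<close>

lemma bases_free_product_Un:
  assumes "ground N \<inter> ground Q = {}" "B \<in> bases N" "D \<in> bases Q"
  shows "B \<union> D \<in> bases (N \<box> Q)"
proof -
  have sub: "B \<subseteq> ground N" "D \<subseteq> ground Q" using assms by (auto dest: bases_subset_ground)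
  then have "(B \<union> D) \<inter> ground N = B" "(B \<union> D) \<inter> ground Q = D" using assms(1) by auto
  moreover have "card (B \<union> D) = card B + card D"
    using assms sub by (intro card_Un_disjoint) (auto dest: finite_bases_mem)
  ultimately show ?thesis
    using assms sub by (auto simp: bases_free_product spanning_def bases_iff)
qed

text \<open>Traces of bases on \<open>ground N\<close> are independent by definition of the product;
  conversely, any basis of \<open>N\<close> extends by an arbitrary basis of
  \<open>Q\<close>.\<close>

lemma restriction_free_product:
  assumes disj: "ground N \<inter> ground Q = {}"
  shows "restriction (N \<box> Q) (ground N) = N"
proof (rule matroid_eqI)
  show "ground (restriction (N \<box> Q) (ground N)) = ground N"
    using disj by (auto simp: ground_free_product)
  obtain D where D: "D \<in> bases Q" using ex_basis by blast
  show "indep_sets (restriction (N \<box> Q) (ground N)) = indep_sets N"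
  proof (intro equalityI subsetI)
    fix X assume "X \<in> indep_sets (restriction (N \<box> Q) (ground N))"
    then obtain B where B: "B \<in> bases (N \<box> Q)" "X \<subseteq> B" "X \<subseteq> ground N"
      by (auto simp: indep_iff_subset_basis)
    then have "B \<inter> ground N \<in> indep_sets N" by (simp add: bases_free_product[OF disj])
    then show "X \<in> indep_sets N" using B by (auto intro: indep_mono)
  next
    fix X assume X: "X \<in> indep_sets N"
    then obtain B where "B \<in> bases N" "X \<subseteq> B" by (auto simp: indep_iff_subset_basis)
    then have "B \<union> D \<in> bases (N \<box> Q)" "X \<subseteq> B \<union> D"
      using bases_free_product_Un[OF disj _ D] by auto
    then show "X \<in> indep_sets (restriction (N \<box> Q) (ground N))"
      using indep_subset_ground[OF X] by (auto simp: indep_iff_subset_basis)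
  qed
qed

text \<open>If a basis \<open>D\<close> of the product contains a basis of \<open>N\<close>, there
  is no room for further elements of \<open>ground N\<close>. Then \<open>D\<close> has exactly
  \<open>rank Q\<close> elements in \<open>ground Q\<close>, and these span, hence form a basis of
  \<open>Q\<close>.\<close>

lemma contraction_free_product:
  assumes disj: "ground N \<inter> ground Q = {}"
  shows "contraction (N \<box> Q) (ground N) = Q"
proof (rule matroid_eqI)
  have gr: "ground (N \<box> Q) - ground N = ground Q"
    using disj by (auto simp: ground_free_product)
  then show "ground (contraction (N \<box> Q) (ground N)) = ground Q" by simp
  show "indep_sets (contraction (N \<box> Q) (ground N)) = indep_sets Q"
  proof (intro equalityI subsetI)
    fix X assume "X \<in> indep_sets (contraction (N \<box> Q) (ground N))"
    then obtain B where X: "X \<subseteq> ground Q" and B: "B \<in> bases N" "X \<union> B \<in> indep_sets (N \<box> Q)"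
      by (auto simp: indep_sets_contraction gr restriction_free_product[OF disj])
    then obtain D where D: "D \<in> bases (N \<box> Q)" "X \<union> B \<subseteq> D"
      by (auto simp: indep_iff_subset_basis)
    then have D': "D \<subseteq> ground N \<union> ground Q" "card D = rank N + rank Q"
      "D \<inter> ground N \<in> indep_sets N" "spanning Q (D \<inter> ground Q)"
      by (auto simp: bases_free_product[OF disj])
    have "B \<subseteq> D \<inter> ground N" using D bases_subset_ground[OF B(1)] by auto
    then have BD: "D \<inter> ground N = B" using D'(3) B(1) unfolding bases_def by blast
    have "card D = card (D \<inter> ground N) + card (D \<inter> ground Q)"
    proof -
      have "D = (D \<inter> ground N) \<union> (D \<inter> ground Q)" using D'(1) by blast
      then show ?thesis
        using card_Un_disjoint[of "D \<inter> ground N" "D \<inter> ground Q"] disj by auto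
    qed
    then have cD: "card (D \<inter> ground Q) = rank Q" using D'(2) B(1) BD by (simp add: bases_iff)
    obtain C where C: "C \<in> bases Q" "C \<subseteq> D \<inter> ground Q" using D'(4) by (auto simp: spanning_def)
    then have "C = D \<inter> ground Q"
      using cD by (intro card_subset_eq) (auto simp: bases_iff)
    then have "C \<in> bases Q \<and> X \<subseteq> C" using C X D by blast
    then show "X \<in> indep_sets Q" by (auto simp: indep_iff_subset_basis)
  next
    fix X assume X: "X \<in> indep_sets Q"
    then obtain D where D: "D \<in> bases Q" "X \<subseteq> D" by (auto simp: indep_iff_subset_basis)
    obtain B where B: "B \<in> bases N" using ex_basis by blast
    have "B \<union> D \<in> bases (N \<box> Q)" using disj B D(1) by (rule bases_free_product_Un)
    moreover have "X \<union> B \<subseteq> B \<union> D" using D by blast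
    ultimately have "X \<union> B \<in> indep_sets (N \<box> Q)" by (auto simp only: indep_iff_subset_basis)
    then show "X \<in> indep_sets (contraction (N \<box> Q) (ground N))"
      using B indep_subset_ground[OF X]
      by (auto simp: indep_sets_contraction gr restriction_free_product[OF disj])
  qed
qed

section \<open>Idempotence and reducibility of the closure\<close>

lemma restriction_free_closure:
  "A \<subseteq> ground P \<Longrightarrow> restriction (free_closure A P) A = restriction P A"
  using restriction_free_product[of "restriction P A" "contraction P A"]
  by (simp add: free_closure_def Int_absorb1)

lemma contraction_free_closure:
  "A \<subseteq> ground P \<Longrightarrow> contraction (free_closure A P) A = contraction P A"
  using contraction_free_product[of "restriction P A" "contraction P A"]
  by (simp add: free_closure_def Int_absorb1)

text \<open>The closure depends only on the two minors at \<open>A\<close>, and taking it does not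
  change them.\<close>

lemma free_closure_idem:
  "A \<subseteq> ground P \<Longrightarrow> free_closure A (free_closure A P) = free_closure A P"
  by (simp add: free_closure_def[of A "free_closure A P"] restriction_free_closure
      contraction_free_closure) (simp add: free_closure_def)

lemma reducible_free_closure:
  assumes "A \<subseteq> ground P" "A \<noteq> {}" "A \<noteq> ground P"
  shows "reducible_matroid (free_closure A P)"
proof -
  have "ground (restriction P A) \<noteq> {}" "ground (contraction P A) \<noteq> {}"
    "ground (restriction P A) \<inter> ground (contraction P A) = {}"
    using assms by auto
  then show ?thesis
    unfolding reducible_matroid_def irreducible_matroid_def free_closure_def by blast
qed

section \<open>The empty matroid and trivial minors\<close>

lemma ground_eq_empty_iff: "ground M = {} \<longleftrightarrow> M = empty_matroid"
proof
  have e: "ground (empty_matroid :: 'a matroid) = {}" "indep_sets (empty_matroid :: 'a matroid) = {{}}"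
    by (simp_all add: ground.rep_eq indep_sets.rep_eq empty_matroid.rep_eq)
  show "M = empty_matroid \<Longrightarrow> ground M = {}" using e by simp
  assume "ground M = {}"
  moreover from this have "indep_sets M = {{}}"
    using indep_subset_ground[of _ M] indep_empty[of M] by auto
  ultimately show "M = empty_matroid" using e by (intro matroid_eqI) simp_all
qed

lemma restriction_ground [simp]: "restriction M (ground M) = M"
  by (rule matroid_eqI) (auto dest: indep_subset_ground)

lemma contraction_empty [simp]: "contraction M {} = M"
proof (rule matroid_eqI)
  have "indep_sets (restriction M {}) = {{}}" by auto
  then have "bases (restriction M {}) = {{}}" by (auto simp: bases_def)
  then show "indep_sets (contraction M {}) = indep_sets M"
    by (auto simp: indep_sets_contraction dest: indep_subset_ground)
qed simp

section \<open>Crapo's closure theorem\<close>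

text \<open>The defining recursion with the term at \<open>z\<close> moved to the other side;
  finiteness of \<open>R\<close> keeps the default value \<open>0\<close> of \<open>moebius\<close>
  out of play.\<close>

lemma sum_moebius_le:
  assumes "finite R" "x \<in> R" "z \<in> R" "x \<le> z" "x \<noteq> z"
  shows "(\<Sum>y\<in>{y \<in> R. x \<le> y \<and> y \<le> z}. moebius R x y) = 0"
proof -
  have "{y \<in> R. x \<le> y \<and> y \<le> z} = insert z {y \<in> R. x \<le> y \<and> y < z}"
    using assms by (auto simp: less_le)
  then show ?thesis
    using assms by (simp add: moebius.simps[of R x z])
qed

text \<open>For closed \<open>z\<close>, the elements below \<open>z\<close> are partitioned by
  their closures, which are the closed elements below \<open>z\<close>. The total Moebius sum
  vanishes, and so do the fibres over smaller closed elements by induction on the size of the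
  down-set; only the fibre over \<open>z\<close> is left.\<close>

lemma sum_moebius_closure_fibre:
  fixes c :: "'b::order \<Rightarrow> 'b"
  assumes R: "finite R" "m \<in> R" "\<And>y. y \<in> R \<Longrightarrow> m \<le> y"
    and c_in: "\<And>y. y \<in> R \<Longrightarrow> c y \<in> R"
    and ext: "\<And>y. y \<in> R \<Longrightarrow> y \<le> c y"
    and mono: "\<And>y z. y \<in> R \<Longrightarrow> z \<in> R \<Longrightarrow> y \<le> z \<Longrightarrow> c y \<le> c z"
    and idem: "\<And>y. y \<in> R \<Longrightarrow> c (c y) = c y"
    and bot: "c m \<noteq> m"
  shows "(\<Sum>y\<in>{y \<in> R. c y = z}. moebius R m y) = 0"
proof (cases "z \<in> R \<and> c z = z")
  case False
  \<comment> \<open>Every value of \<open>c\<close> on \<open>R\<close> is a closed element of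
    \<open>R\<close>.\<close>
  then have "{y \<in> R. c y = z} = {}" using c_in idem by auto
  then show ?thesis by (simp only: sum.empty)
next
  case True
  define n where "n = card {y \<in> R. y \<le> z}"
  from n_def True show ?thesis
  proof (induction n arbitrary: z rule: less_induct)
    case (less n z)
    then have z: "z \<in> R" "c z = z" by auto
    define W where "W = {w \<in> R. c w = w \<and> w \<le> z}"
    have fW: "finite W" "z \<in> W" using R z by (auto simp: W_def)
    have lower: "(\<Sum>y\<in>{y \<in> R. c y = w}. moebius R m y) = 0" if "w \<in> W" "w \<noteq> z" for w
    proof -
      have "{y \<in> R. y \<le> w} \<subset> {y \<in> R. y \<le> z}"
        using that z by (auto simp: W_def dest: order_trans intro: antisym)
      then have "card {y \<in> R. y \<le> w} < n"
        unfolding less.prems(1) using R by (intro psubset_card_mono) auto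
      then show ?thesis using less.IH that by (auto simp: W_def)
    qed
    have below: "c y \<le> z" if "y \<in> R" "y \<le> z" for y using mono[of y z] that z by simp
    \<comment> \<open>The Galois property of a closure: for closed \<open>z\<close>, an element lies
      below \<open>z\<close> exactly when its closure does.\<close>
    have "m \<le> y \<and> y \<le> z \<longleftrightarrow> c y \<in> W" if "y \<in> R" for y
      using R(3)[OF that] c_in[OF that] idem[OF that] below[OF that] order_trans[OF ext[OF that]]
      unfolding W_def by blast
    then have eq: "{y \<in> R. m \<le> y \<and> y \<le> z} = (\<Union>w\<in>W. {y \<in> R. c y = w})" by blast
    \<comment> \<open>\<open>z\<close> differs from \<open>m\<close> because \<open>z\<close> is
      closed and, by \<open>bot\<close>, \<open>m\<close> is not.\<close>
    have "0 = (\<Sum>y\<in>{y \<in> R. m \<le> y \<and> y \<le> z}. moebius R m y)"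
      using R z bot by (subst sum_moebius_le) auto
    also have "\<dots> = (\<Sum>w\<in>W. \<Sum>y\<in>{y \<in> R. c y = w}. moebius R m y)"
      unfolding eq using fW R by (intro sum.UNION_disjoint) auto
    also have "\<dots> = (\<Sum>y\<in>{y \<in> R. c y = z}. moebius R m y)"
      using fW lower by (subst sum.remove[of _ z]) auto
    finally show ?case by simp
  qed
qed

section \<open>Coefficients of the coproduct\<close>

lemma lookup_lin_ext:
  "Poly_Mapping.lookup (lin_ext f x) c =
    (\<Sum>b\<in>Poly_Mapping.keys x. Poly_Mapping.lookup x b * Poly_Mapping.lookup (f b) c)"
  by (simp add: lin_ext_def lookup_sum)

lemma lookup_tensor:
  "Poly_Mapping.lookup (x \<otimes> y) (b, c) = Poly_Mapping.lookup x b * Poly_Mapping.lookup y c"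
proof -
  have "Poly_Mapping.lookup (x \<otimes> y) (b, c) =
    (\<Sum>b'\<in>Poly_Mapping.keys x. \<Sum>c'\<in>Poly_Mapping.keys y.
      if b' = b then (if c' = c then Poly_Mapping.lookup x b * Poly_Mapping.lookup y c else 0) else 0)"
    by (auto simp: tensor_def lookup_sum lookup_single when_def intro!: sum.cong)
  also have "\<dots> = (\<Sum>b'\<in>Poly_Mapping.keys x. if b' = b then
      (\<Sum>c'\<in>Poly_Mapping.keys y. if c' = c then Poly_Mapping.lookup x b * Poly_Mapping.lookup y c else 0) else 0)"
    by (intro sum.cong) auto
  also have "\<dots> = Poly_Mapping.lookup x b * Poly_Mapping.lookup y c"
    by (auto simp: in_keys_iff)
  finally show ?thesis .
qed

lemma lookup_basis_vec: "Poly_Mapping.lookup (basis_vec b) c = (if b = c then 1 else 0)"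
  by (simp add: basis_vec_def lookup_single when_def)

text \<open>These are the matroids whose coproduct contains the term \<open>(N, Q)\<close>; the
  subset producing it is forced to be \<open>ground N\<close>.\<close>

definition minor_fibre :: "'a matroid \<Rightarrow> 'a matroid \<Rightarrow> 'a matroid set" where
  "minor_fibre N Q =
    {P. ground N \<subseteq> ground P \<and> restriction P (ground N) = N \<and> contraction P (ground N) = Q}"

lemma finite_matroids_on [simp]: "finite {P :: 'a matroid. ground P = S}"
proof (cases "finite S")
  case True
  show ?thesis
  proof (rule inj_on_finite[of indep_sets _ "Pow (Pow S)"])
    show "inj_on indep_sets {N. ground N = S}"
      by (auto simp: inj_on_def intro: matroid_eqI)
    show "indep_sets ` {N. ground N = S} \<subseteq> Pow (Pow S)"
      using indep_subset_ground by fastforce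
  qed (use True in simp)
next
  case False
  then have "{P :: 'a matroid. ground P = S} = {}" using finite_ground by blast
  then show ?thesis by (simp only: finite.emptyI)
qed

lemma minor_fibre_ground:
  assumes "P \<in> minor_fibre N Q"
  shows "ground P = ground N \<union> ground Q" "ground N \<inter> ground Q = {}"
proof -
  have "ground N \<subseteq> ground P" "ground Q = ground P - ground N"
    using assms by (auto simp: minor_fibre_def)
  then show "ground P = ground N \<union> ground Q" "ground N \<inter> ground Q = {}" by auto
qed

lemma finite_minor_fibre [simp]: "finite (minor_fibre N Q)"
  by (rule finite_subset[of _ "{P. ground P = ground N \<union> ground Q}"])
     (auto dest: minor_fibre_ground)

text \<open>At most one subset of each ground set yields \<open>(N, Q)\<close>, so every matroid
  contributes its coefficient either once or not at all.\<close>

lemma lookup_coproduct: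
  fixes x :: "'a matroid \<Rightarrow>\<^sub>0 'k::field"
  shows "Poly_Mapping.lookup (coproduct x) (N, Q) = (\<Sum>P\<in>minor_fibre N Q. Poly_Mapping.lookup x P)"
proof -
  have inner: "(\<Sum>A\<in>Pow (ground P). Poly_Mapping.lookup (basis_vec (restriction P A)) N *
      Poly_Mapping.lookup (basis_vec (contraction P A)) Q) =
      (if P \<in> minor_fibre N Q then 1 else (0 :: 'k))" for P
  proof -
    have "restriction P A = N \<longleftrightarrow> A = ground N \<and> restriction P A = N" if "A \<subseteq> ground P" for A
      using that by auto
    then have "(\<Sum>A\<in>Pow (ground P). Poly_Mapping.lookup (basis_vec (restriction P A)) N *
      Poly_Mapping.lookup (basis_vec (contraction P A)) Q) =
      (\<Sum>A\<in>Pow (ground P). if A = ground N then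
        (if restriction P (ground N) = N \<and> contraction P (ground N) = Q then 1 else (0 :: 'k)) else 0)"
      by (intro sum.cong) (auto simp: lookup_basis_vec)
    also have "\<dots> = (if P \<in> minor_fibre N Q then 1 else 0)"
      by (auto simp: minor_fibre_def)
    finally show ?thesis .
  qed
  have "Poly_Mapping.lookup (coproduct x) (N, Q) =
    (\<Sum>P\<in>Poly_Mapping.keys x. if P \<in> minor_fibre N Q then Poly_Mapping.lookup x P else 0)"
    unfolding coproduct_def lookup_lin_ext
    by (intro sum.cong refl) (simp add: lookup_sum lookup_tensor inner)
  also have "\<dots> = (\<Sum>P\<in>Poly_Mapping.keys x \<inter> minor_fibre N Q. Poly_Mapping.lookup x P)"
    by (simp add: sum.inter_restrict)
  \<comment> \<open>Fibre members outside the support add only zeros.\<close>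
  also have "\<dots> = (\<Sum>P\<in>minor_fibre N Q. Poly_Mapping.lookup x P)"
    by (intro sum.mono_neutral_left) (auto simp: in_keys_iff)
  finally show ?thesis .
qed

lemma counit_eq_lookup: "counit x = Poly_Mapping.lookup x empty_matroid"
proof -
  have "counit x = (\<Sum>M\<in>Poly_Mapping.keys x. if M = empty_matroid then Poly_Mapping.lookup x M else 0)"
    unfolding counit_def by (intro sum.cong) (auto simp: ground_eq_empty_iff)
  then show ?thesis by (simp add: in_keys_iff)
qed

lemma minor_fibre_empty_left: "minor_fibre empty_matroid Q = {Q}"
proof -
  have g: "ground (empty_matroid :: 'a matroid) = {}" by (simp add: ground_eq_empty_iff)
  have "restriction P {} = empty_matroid" for P :: "'a matroid"
    by (simp flip: ground_eq_empty_iff)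
  then show ?thesis by (auto simp: minor_fibre_def g)
qed

lemma minor_fibre_empty_right: "minor_fibre N empty_matroid = {N}"
proof -
  have "contraction N (ground N) = empty_matroid"
    by (simp flip: ground_eq_empty_iff)
  moreover have "P = N" if "P \<in> minor_fibre N empty_matroid" for P
  proof -
    have "ground P = ground N"
      using minor_fibre_ground(1)[OF that] by (simp add: ground_eq_empty_iff[THEN iffD2])
    then show ?thesis using that restriction_ground[of P] by (simp add: minor_fibre_def)
  qed
  ultimately show ?thesis by (auto simp: minor_fibre_def)
qed

text \<open>Comparing coefficients at \<open>(N, Q)\<close> gives a genuine condition only when both
  matroids are nonempty: otherwise the fibre is a singleton, and the condition follows from the
  vanishing counit.\<close>

lemma primitives_iff:
  "x \<in> primitives \<longleftrightarrow> Poly_Mapping.lookup x empty_matroid = 0 \<and>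
    (\<forall>N Q. ground N \<noteq> {} \<longrightarrow> ground Q \<noteq> {} \<longrightarrow> (\<Sum>P\<in>minor_fibre N Q. Poly_Mapping.lookup x P) = 0)"
  (is "_ \<longleftrightarrow> ?R")
proof -
  have rhs: "Poly_Mapping.lookup (basis_vec empty_matroid \<otimes> x + x \<otimes> basis_vec empty_matroid) (N, Q) =
    (if N = empty_matroid then Poly_Mapping.lookup x Q else 0) +
    (if Q = empty_matroid then Poly_Mapping.lookup x N else 0)" for N Q
    by (simp add: lookup_add lookup_tensor lookup_basis_vec)
  show ?thesis
  proof
    assume "x \<in> primitives"
    then have x: "Poly_Mapping.lookup x empty_matroid = 0"
      "coproduct x = basis_vec empty_matroid \<otimes> x + x \<otimes> basis_vec empty_matroid"
      by (auto simp: primitives_def counit_eq_lookup)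
    have "(\<Sum>P\<in>minor_fibre N Q. Poly_Mapping.lookup x P) = 0"
      if "ground N \<noteq> {}" "ground Q \<noteq> {}" for N Q
      using that rhs[of N Q] unfolding lookup_coproduct[symmetric] x(2)
      by (simp add: ground_eq_empty_iff)
    then show ?R using x(1) by blast
  next
    assume R: ?R
    have "coproduct x = basis_vec empty_matroid \<otimes> x + x \<otimes> basis_vec empty_matroid"
    proof (rule poly_mapping_eqI)
      fix NQ :: "'a matroid \<times> 'a matroid"
      obtain N Q where NQ: "NQ = (N, Q)" by (cases NQ)
      \<comment> \<open>At the pair of two empty matroids the right side is twice the coefficient at
        \<open>empty_matroid\<close>, which agrees with the left side because that coefficient is
        zero.\<close>
      show "Poly_Mapping.lookup (coproduct x) NQ =
        Poly_Mapping.lookup (basis_vec empty_matroid \<otimes> x + x \<otimes> basis_vec empty_matroid) NQ"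
        unfolding NQ rhs lookup_coproduct using R
        by (auto simp: ground_eq_empty_iff minor_fibre_empty_left minor_fibre_empty_right)
    qed
    then show "x \<in> primitives" using R by (auto simp: primitives_def counit_eq_lookup)
  qed
qed

lemma subspace_primitives: "free_vs.subspace primitives"
  by (auto simp: free_vs.subspace_def primitives_iff lookup_add sum.distrib simp flip: sum_distrib_left)

section \<open>The primitive elements\<close>

text \<open>Since a free product determines its factors, fibres of the coproduct are fibres of a
  closure operator. This is what makes Crapo's theorem applicable to primitivity.\<close>

lemma mem_minor_fibre_iff_free_closure:
  assumes "ground N \<inter> ground Q = {}" "ground P = ground N \<union> ground Q"
  shows "P \<in> minor_fibre N Q \<longleftrightarrow> free_closure (ground N) P = N \<box> Q"
proof
  assume "P \<in> minor_fibre N Q"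
  then show "free_closure (ground N) P = N \<box> Q" by (simp add: minor_fibre_def free_closure_def)
next
  assume eq: "free_closure (ground N) P = N \<box> Q"
  have "ground N \<subseteq> ground P" using assms by auto
  then show "P \<in> minor_fibre N Q"
    using restriction_free_closure[of "ground N" P] contraction_free_closure[of "ground N" P]
      restriction_free_product[OF assms(1)] contraction_free_product[OF assms(1)]
    by (simp add: minor_fibre_def eq)
qed

lemma minor_fibre_le_free_product: "P \<in> minor_fibre N Q \<Longrightarrow> P \<le> N \<box> Q"
  using free_closure_extensive[of "ground N" P]
  by (auto simp: minor_fibre_def free_closure_def)

section \<open>Coefficients and primitivity of \<open>r_elem\<close>\<close>

lemma lookup_r_elem:
  "Poly_Mapping.lookup (r_elem M) N =
    (if N \<in> R_above M then of_int (moebius (R_above M) M N) else 0)"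
  by (simp add: r_elem_def lookup_sum lookup_basis_vec if_distrib cong: if_cong)

lemma lookup_r_elem_self: "Poly_Mapping.lookup (r_elem M) M = 1"
proof -
  have "M \<in> R_above M" by (simp add: R_above_def)
  then show ?thesis by (simp add: lookup_r_elem moebius.simps[of _ M M])
qed

text \<open>Every element of \<open>R_above M\<close> other than \<open>M\<close> is reducible. So
  the irreducible coefficients act as dual coordinates to the family \<open>r_elem\<close>.\<close>

lemma lookup_r_elem_irreducible:
  "irreducible_matroid N \<Longrightarrow> Poly_Mapping.lookup (r_elem M) N = (if N = M then 1 else 0)"
  by (auto simp: lookup_r_elem_self) (simp add: lookup_r_elem R_above_def reducible_matroid_def)

lemma R_above_ground: "N \<in> R_above M \<Longrightarrow> ground N = ground M"
  by (auto simp: R_above_def less_eq_matroid_def)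

lemma R_above_ge: "N \<in> R_above M \<Longrightarrow> M \<le> N"
  by (auto simp: R_above_def)

lemma r_elem_primitive:
  assumes M: "irreducible_matroid M"
  shows "r_elem M \<in> primitives"
  unfolding primitives_iff
proof (intro conjI allI impI)
  have "ground M \<noteq> {}" using M by (simp add: irreducible_matroid_def)
  then have "empty_matroid \<notin> R_above M"
    using R_above_ground ground_eq_empty_iff by metis
  then show "Poly_Mapping.lookup (r_elem M) empty_matroid = 0" by (simp add: lookup_r_elem)
next
  fix N Q :: "'a matroid"
  assume ne: "ground N \<noteq> {}" "ground Q \<noteq> {}"
  let ?A = "ground N"
  let ?R = "R_above M"
  have sum_eq: "(\<Sum>P\<in>minor_fibre N Q. Poly_Mapping.lookup (r_elem M) P) =
    of_int (\<Sum>P\<in>minor_fibre N Q \<inter> ?R. moebius ?R M P)"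
    by (simp add: lookup_r_elem sum.inter_restrict if_distrib[of of_int] cong: if_cong)
  show "(\<Sum>P\<in>minor_fibre N Q. Poly_Mapping.lookup (r_elem M) P) = 0"
  proof (cases "ground N \<inter> ground Q = {} \<and> ground M = ground N \<union> ground Q")
    \<comment> \<open>All of \<open>R_above M\<close> lives on \<open>ground M\<close>, so the fibre
      misses it if the ground sets do not fit.\<close>
    case False
    then have "minor_fibre N Q \<inter> ?R = {}"
      using minor_fibre_ground R_above_ground by blast
    then show ?thesis using sum_eq by simp
  next
    case True
    have g: "?A \<subseteq> ground P" "?A \<noteq> ground P" if "P \<in> ?R" for P
      using True ne R_above_ground[OF that] by auto
    have red: "reducible_matroid (free_closure ?A P)" if "P \<in> ?R" for P
      using g[OF that] ne by (intro reducible_free_closure)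
    have M_in: "M \<in> ?R" by (simp add: R_above_def)
    have "minor_fibre N Q \<inter> ?R = {P \<in> ?R. free_closure ?A P = N \<box> Q}"
      using True mem_minor_fibre_iff_free_closure[of N Q] R_above_ground[of _ M] by auto
    moreover have "(\<Sum>P\<in>{P \<in> ?R. free_closure ?A P = N \<box> Q}. moebius ?R M P) = 0"
    proof (rule sum_moebius_closure_fibre)
      show "free_closure ?A P \<in> ?R" if "P \<in> ?R" for P
        using red[OF that] order_trans[OF R_above_ge[OF that] free_closure_extensive[OF g(1)[OF that]]]
        by (simp add: R_above_def)
      \<comment> \<open>This is where irreducibility of \<open>M\<close> enters: the closure is
        reducible.\<close>
      show "free_closure ?A M \<noteq> M"
        using red[OF M_in] M by (auto simp: reducible_matroid_def)
    qed (use g in \<open>auto simp: M_in intro: R_above_ge free_closure_extensive free_closure_mono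
        free_closure_idem\<close>)
    ultimately show ?thesis using sum_eq by simp
  qed
qed

text \<open>Applied to differences, this says that a primitive element is determined by its
  coefficients at irreducible matroids; spanning and uniqueness both rest on it.\<close>

lemma primitive_reducible_support_eq_0:
  assumes x: "x \<in> primitives"
    and supp: "\<And>M. irreducible_matroid M \<Longrightarrow> Poly_Mapping.lookup x M = 0"
  shows "x = 0"
proof (rule ccontr)
  assume "x \<noteq> 0"
  then have "Poly_Mapping.keys x \<noteq> {}" by simp
  then obtain P where P: "P \<in> Poly_Mapping.keys x" "\<forall>P'\<in>Poly_Mapping.keys x. P' \<le> P \<longrightarrow> P = P'"
    using finite_has_minimal[of "Poly_Mapping.keys x"] finite_keys by blast
  then have "\<not> irreducible_matroid P" using supp by (auto simp: in_keys_iff)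
  \<comment> \<open>The empty matroid counts as reducible without being a product of nonempty
    factors, so it has to be excluded through the counit.\<close>
  moreover have "ground P \<noteq> {}"
    using P x by (auto simp: ground_eq_empty_iff primitives_iff in_keys_iff)
  ultimately obtain N Q where NQ: "ground N \<noteq> {}" "ground Q \<noteq> {}" "ground N \<inter> ground Q = {}"
    "P = N \<box> Q"
    by (auto simp: irreducible_matroid_def)
  have "P \<in> minor_fibre N Q"
    using NQ by (simp add: minor_fibre_def ground_free_product restriction_free_product
        contraction_free_product)
  \<comment> \<open>The other members of the fibre lie strictly below \<open>P\<close>, hence
    outside the support by minimality.\<close>
  moreover have "Poly_Mapping.lookup x P' = 0" if "P' \<in> minor_fibre N Q" "P' \<noteq> P" for P'
    using minor_fibre_le_free_product[OF that(1)] P NQ(4) that(2) by (auto simp: in_keys_iff)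
  ultimately have "(\<Sum>P'\<in>minor_fibre N Q. Poly_Mapping.lookup x P') = Poly_Mapping.lookup x P"
    by (subst sum.remove[of _ P]) auto
  moreover have "(\<Sum>P'\<in>minor_fibre N Q. Poly_Mapping.lookup x P') = 0"
    using x NQ by (simp add: primitives_iff)
  ultimately show False using P by (simp add: in_keys_iff)
qed

section \<open>Basis property, homogeneity and uniqueness\<close>

lemma subspace_lookup_eq_0: "free_vs.subspace {x. Poly_Mapping.lookup x b = 0}"
  by (auto simp: free_vs.subspace_def lookup_add)

lemma independent_r_elem:
  "free_vs.independent
    ((r_elem :: 'a matroid \<Rightarrow> ('a matroid \<Rightarrow>\<^sub>0 'k::field)) ` {M. irreducible_matroid M})"
  (is "free_vs.independent (?r ` ?I)")
proof
  assume "free_vs.dependent (?r ` ?I)"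
  then obtain M where M: "irreducible_matroid M" "?r M \<in> free_vs.span (?r ` ?I - {?r M})"
    by (auto simp: free_vs.dependent_def)
  \<comment> \<open>The coefficient at \<open>M\<close> is a linear functional that kills all the
    other generators but equals \<open>1\<close> on \<open>?r M\<close>.\<close>
  have "free_vs.span (?r ` ?I - {?r M}) \<subseteq> {x. Poly_Mapping.lookup x M = 0}"
    by (rule free_vs.span_minimal[OF _ subspace_lookup_eq_0])
       (auto simp: lookup_r_elem_irreducible[OF M(1)])
  then show False using M(2) by (auto simp: lookup_r_elem_self)
qed

lemma span_r_elem:
  "free_vs.span
    ((r_elem :: 'a matroid \<Rightarrow> ('a matroid \<Rightarrow>\<^sub>0 'k::field)) ` {M. irreducible_matroid M}) = primitives"
  (is "free_vs.span (?r ` ?I) = _")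
proof
  show "free_vs.span (?r ` ?I) \<subseteq> primitives"
    by (rule free_vs.span_minimal[OF _ subspace_primitives]) (auto intro: r_elem_primitive)
  show "primitives \<subseteq> free_vs.span (?r ` ?I)"
  proof
    fix x :: "'a matroid \<Rightarrow>\<^sub>0 'k"
    assume x: "x \<in> primitives"
    \<comment> \<open>Chosen to have the same irreducible coefficients as \<open>x\<close>, so that
      \<open>x - y\<close> is a primitive element with reducible support.\<close>
    define y where "y = (\<Sum>M\<in>Poly_Mapping.keys x \<inter> ?I. scale (Poly_Mapping.lookup x M) (?r M))"
    have y: "y \<in> free_vs.span (?r ` ?I)"
      unfolding y_def by (intro free_vs.span_sum free_vs.span_scale free_vs.span_base) auto
    then have "y \<in> primitives" using \<open>free_vs.span (?r ` ?I) \<subseteq> primitives\<close> by blast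
    then have "x - y \<in> primitives" using x free_vs.subspace_diff[OF subspace_primitives] by blast
    moreover have "Poly_Mapping.lookup (x - y) N = 0" if "irreducible_matroid N" for N
    proof -
      have "Poly_Mapping.lookup y N =
        (\<Sum>M\<in>Poly_Mapping.keys x \<inter> ?I. if N = M then Poly_Mapping.lookup x M else 0)"
        unfolding y_def lookup_sum
        by (intro sum.cong) (auto simp: lookup_r_elem_irreducible[OF that])
      also have "\<dots> = Poly_Mapping.lookup x N"
        using that by (auto simp: in_keys_iff)
      finally show ?thesis by (simp add: lookup_minus)
    qed
    ultimately have "x - y = 0" by (rule primitive_reducible_support_eq_0)
    then show "x \<in> free_vs.span (?r ` ?I)" using y by simp
  qed
qed

lemma r_elem_homogeneous: "r_elem M \<in> homogeneous_component (ground M)"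
  unfolding r_elem_def homogeneous_component_def
  by (intro free_vs.span_sum free_vs.span_scale free_vs.span_base) (auto dest: R_above_ground)

text \<open>Both \<open>x\<close> and \<open>r_elem M\<close> have coefficient \<open>1\<close> at
  \<open>M\<close> and \<open>0\<close> at every other irreducible matroid, so their primitive
  difference has reducible support.\<close>

lemma primitive_eq_r_elem:
  assumes x: "x \<in> primitives" and M: "irreducible_matroid M"
    and y: "y \<in> free_vs.span (basis_vec ` {N. reducible_matroid N})" and eq: "x = basis_vec M + y"
  shows "x = r_elem M"
proof -
  have "x - r_elem M \<in> primitives"
    using x r_elem_primitive[OF M] free_vs.subspace_diff[OF subspace_primitives] by blast
  moreover have "Poly_Mapping.lookup (x - r_elem M) N = 0" if N: "irreducible_matroid N" for N
  proof -
    have "free_vs.span (basis_vec ` {N. reducible_matroid N}) \<subseteq> {x. Poly_Mapping.lookup x N = 0}"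
      by (rule free_vs.span_minimal[OF _ subspace_lookup_eq_0])
         (use N in \<open>auto simp: lookup_basis_vec reducible_matroid_def\<close>)
    then have "Poly_Mapping.lookup y N = 0" using y by blast
    then show ?thesis
      by (auto simp: eq lookup_minus lookup_add lookup_basis_vec lookup_r_elem_irreducible[OF N])
  qed
  ultimately have "x - r_elem M = 0" by (rule primitive_reducible_support_eq_0)
  then show ?thesis by simp
qed

theorem theorem11:
  fixes r :: "'a matroid \<Rightarrow> ('a matroid \<Rightarrow>\<^sub>0 'k::field)"
  assumes "infinite (UNIV :: 'a set)"
  defines "r \<equiv> r_elem"
  shows "free_vs.independent (r ` {M. irreducible_matroid M})
       \<and> free_vs.span (r ` {M. irreducible_matroid M}) = primitives
       \<and> (\<forall>b \<in> r ` {M. irreducible_matroid M}. \<exists>S. finite S \<and> b \<in> homogeneous_component S)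
       \<and> (\<forall>x \<in> primitives. \<forall>M y. irreducible_matroid M \<longrightarrow>
            y \<in> free_vs.span (basis_vec ` {N. reducible_matroid N}) \<longrightarrow>
            x = basis_vec M + y \<longrightarrow> x = r M)"
proof (intro conjI ballI allI impI)
  show "free_vs.independent (r ` {M. irreducible_matroid M})"
    unfolding r_def by (rule independent_r_elem)
  show "free_vs.span (r ` {M. irreducible_matroid M}) = primitives"
    unfolding r_def by (rule span_r_elem)
  show "\<exists>S. finite S \<and> b \<in> homogeneous_component S"
    if "b \<in> r ` {M. irreducible_matroid M}" for b
    using that r_elem_homogeneous finite_ground unfolding r_def by blast
  show "x = r M"
    if "x \<in> primitives" "irreducible_matroid M"
      "y \<in> free_vs.span (basis_vec ` {N. reducible_matroid N})" "x = basis_vec M + y" for x M y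
    unfolding r_def using that by (rule primitive_eq_r_elem)
qed

end
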